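(* Let $\mathcal{M} = \langle \mathcal{S},\mathcal{A},\tau,\mu_0,\_,\gamma\rangle$ be an environment. No function in $\mathcal{O}^{\mathcal{M}}$ is $\mathrm{ORD}^{\mathcal{M}}$-admissible. The only function in $\mathcal{O}^{\mathcal{M}}$ that is $\mathrm{OPT}^{\mathcal{M}}$-admissible is $o_m^{\mathcal{M}}$, but $o_m^{\mathcal{M}}$ is not $\mathrm{OPT}^{\mathcal{M}}$-robust to any misspecification (i.e. there is no reward object $g$ such that $o_m^{\mathcal{M}}$ is $\mathrm{OPT}^{\mathcal{M}}$-robust to misspecification with $g$).
   Context: $\mathcal{S}$ (states) and $\mathcal{A}$ (actions) are finite sets; $\tau$ maps each $(s,a)\in\mathcal{S}\times\mathcal{A}$ to a probability distribution on $\mathcal{S}$; $\mu_0$ is a probability distribution on $\mathcal{S}$; $\gamma\in(0,1]$ is the discount. All states are assumed reachable under $\tau$ and $\mu_0$. $\mathcal{R}$ is the set of all functions $R:\mathcal{S}\times\mathcal{A}\times\mathcal{S}\to\mathbb{R}$. A policy $\pi$ maps each state to a probability distribution on $\mathcal{A}$. $\mathcal{J}_i(\pi)=\mathbb{E}_{\xi\sim\pi}[\sum_{t=0}^\infty\gamma^tR_i(s_t,a_t,s_{t+1})]$ (with $s_0\sim\mu_0$, $a_t\sim\pi(s_t)$, $s_{t+1}\sim\tau(s_t,a_t)$); $Q^\star,V^\star$ are the optimal $Q$- and value functions and $A^\star(s,a)=Q^\star(s,a)-V^\star(s)$ is the optimal advantage function; these are taken to be well-defined real numbers. An action $a$ is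 optimal in $s$ if $a\in\mathrm{argmax}_{a\in\mathcal{A}}A^\star(s,a)$. A policy is optimal if and only if, in every state, it only gives support to actions that are optimal in that state. $\mathcal{O}^{\mathcal{M}}$ is the set of all functions $o$ that send each $R\in\mathcal{R}$ to a function $o(R):\mathcal{S}\to\mathcal{P}(\mathcal{A})\setminus\{\varnothing\}$ such that, for each $s$, $o(R)(s)$ is a non-empty subset of the set of actions optimal in $s$ in the MDP $\langle \mathcal{S},\mathcal{A},\tau,\mu_0,R,\gamma\rangle$. $o_m^{\mathcal{M}}\in\mathcal{O}^{\mathcal{M}}$ is the function for which $o_m^{\mathcal{M}}(R)(s)$ is the set of all actions optimal in $s$. A reward object is a function $f:\mathcal{R}\to X$ for some set $X$. Given an equivalence relation (partition) $P$ on $\mathcal{R}$: $f$ is $P$-admissible if $f(R_1)=f(R_2)\Rightarrow R_1\equiv_P R_2$; $f$ is $P$-robust to misspecification with $g$ if $f$ is $P$-admissible, $f\neq g$, $\mathrm{Im}(g)\subseteq\mathrm{Im}(f)$, and $f(R_1)=g(R_2)\Rightarrow R_1\equiv_P R_2$ for all $R_1,R_2\in\mathcal{R}$. $R_1\equiv_{\mathrm{OPT}^{\mathcal{M}}}R_2$ means that $R_1$ and $R_2$ have the same set of optimal policies in $\mathcal{M}$. $R_1\equiv_{\mathrm{ORD}^{\mathcal{M}}}R_2$ means: for all policies $\pi,\pi'$, $\mathcal{J}_1(\pi)>\mathcal{J}_1(\pi')$ iff $\mathcal{J}_2(\pi)>\mathcal{J}_2(\pi')$.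
   Formalization: The ORD claim is proved only when there are at least 2 actions and not (exactly 1 state and 2 actions): with 1 action every function is ORD-admissible, and with 1 state and 2 actions o_m is. The values being well-defined for all rewards is an explicit hypothesis (it forces γ<1). *)

theory Defs
  imports "HOL-Probability.Probability"
begin

section \<open>Environments and policies\<close>

record ('s, 'a) environment =
  transition :: "'s \<Rightarrow> 'a \<Rightarrow> 's pmf"
  init :: "'s pmf"
  disc :: real

type_synonym ('s, 'a) reward = "'s \<Rightarrow> 'a \<Rightarrow> 's \<Rightarrow> real"

type_synonym ('s, 'a) policy = "'s \<Rightarrow> 'a pmf"

inductive reachable :: "('s, 'a) environment \<Rightarrow> 's \<Rightarrow> bool" for M where
  reachable_init: "s \<in> set_pmf (init M) \<Longrightarrow> reachable M s"
| reachable_step: "reachable M s \<Longrightarrow> s' \<in> set_pmf (transition M s a) \<Longrightarrow> reachable M s'"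

definition environment :: "('s, 'a) environment \<Rightarrow> bool" where
  "environment M \<longleftrightarrow> 0 < disc M \<and> disc M \<le> 1 \<and> (\<forall>s. reachable M s)"


section \<open>Trajectories\<close>

text \<open>
  A trajectory is a sequence of state-action pairs; the successor state in the \<open>t\<close>-th reward is
  the state component of entry \<open>Suc t\<close>. The law of the first pair is a parameter \<open>D\<close>, so that
  one construction covers the starts from \<open>init M\<close>, from a fixed state, and from a fixed
  state-action pair.
\<close>

definition act :: "('s, 'a) policy \<Rightarrow> 's pmf \<Rightarrow> ('s \<times> 'a) pmf" where
  "act \<pi> p = bind_pmf p (\<lambda>s. map_pmf (Pair s) (\<pi> s))"

definition traj_kernel :: "('s, 'a) environment \<Rightarrow> ('s, 'a) policy \<Rightarrow> ('s \<times> 'a) pmf \<Rightarrow>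
    nat \<Rightarrow> (nat \<Rightarrow> 's \<times> 'a) \<Rightarrow> ('s \<times> 'a) measure" where
  "traj_kernel M \<pi> D n \<xi> = measure_pmf
     (case n of 0 \<Rightarrow> D | Suc m \<Rightarrow> act \<pi> (transition M (fst (\<xi> m)) (snd (\<xi> m))))"

lemma Ionescu_Tulcea_traj_kernel:
  fixes M :: "('s::finite, 'a::finite) environment"
  shows "Ionescu_Tulcea (traj_kernel M \<pi> D) (\<lambda>_. count_space UNIV)"
proof (rule Ionescu_Tulcea.intro)
  fix n :: nat
  show "traj_kernel M \<pi> D n \<in> PiM {0..<n} (\<lambda>_. count_space UNIV) \<rightarrow>\<^sub>M subprob_algebra (count_space UNIV)"
  proof (cases n)
    case 0
    then show ?thesis
      unfolding traj_kernel_def by (auto simp: space_subprob_algebra intro!: measure_pmf.subprob_space_axioms)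
  next
    case (Suc m)
    have "(\<lambda>\<xi>. \<xi> m) \<in> PiM {0..<n} (\<lambda>_. count_space UNIV) \<rightarrow>\<^sub>M
        (count_space UNIV :: ('s \<times> 'a) measure)"
      using Suc by (intro measurable_component_singleton) auto
    moreover have "(\<lambda>x. measure_pmf (act \<pi> (transition M (fst x) (snd x)))) \<in>
        count_space UNIV \<rightarrow>\<^sub>M subprob_algebra (count_space UNIV)"
      by (rule measurable_measure_pmf)
    ultimately have "(\<lambda>\<xi>. measure_pmf (act \<pi> (transition M (fst (\<xi> m)) (snd (\<xi> m))))) \<in>
        PiM {0..<n} (\<lambda>_. count_space UNIV) \<rightarrow>\<^sub>M subprob_algebra (count_space UNIV)"
      by (rule measurable_compose)
    with Suc show ?thesis
      unfolding traj_kernel_def by simp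
  qed
qed (simp add: traj_kernel_def prob_space_measure_pmf)

definition traj :: "('s, 'a) environment \<Rightarrow> ('s, 'a) policy \<Rightarrow> ('s \<times> 'a) pmf \<Rightarrow>
    (nat \<Rightarrow> 's \<times> 'a) measure" where
  "traj M \<pi> D = projective_family.lim UNIV
     (Ionescu_Tulcea.CI (traj_kernel M \<pi> D) (\<lambda>_. count_space UNIV)) (\<lambda>_. count_space UNIV)"

lemma
  fixes M :: "('s::finite, 'a::finite) environment"
  shows prob_space_traj: "prob_space (traj M \<pi> D)"
    and sets_traj [measurable_cong]: "sets (traj M \<pi> D) = sets (PiM UNIV (\<lambda>_. count_space UNIV))"
proof -
  interpret IT: Ionescu_Tulcea "traj_kernel M \<pi> D" "\<lambda>_. count_space UNIV"
    by (rule Ionescu_Tulcea_traj_kernel)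
  show sets: "sets (traj M \<pi> D) = sets (PiM UNIV (\<lambda>_. count_space UNIV))"
    unfolding traj_def by (rule IT.PF.sets_lim)
  show "prob_space (traj M \<pi> D)"
    unfolding traj_def
  proof (rule prob_space_distrD)
    show "(\<lambda>\<xi>. restrict \<xi> {}) \<in> IT.PF.lim \<rightarrow>\<^sub>M PiM {} (\<lambda>_. count_space UNIV)"
      by (subst measurable_cong_sets[OF IT.PF.sets_lim refl]) (rule measurable_restrict_subset, simp)
    show "prob_space (distr IT.PF.lim (PiM {} (\<lambda>_. count_space UNIV)) (\<lambda>\<xi>. restrict \<xi> {}))"
      using IT.PF.prob_space_P[of "{}"] by (subst IT.distr_lim) auto
  qed
qed

text \<open>The construction is the intended one: the cylinder probabilities are the Markov ones.\<close>

lemma emeasure_traj_cylinder: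
  fixes M :: "('s::finite, 'a::finite) environment"
  shows "emeasure (traj M \<pi> D) {\<xi>. \<forall>i\<le>n. \<xi> i = x i} =
    ennreal (pmf D (x 0) * (\<Prod>i<n. pmf (act \<pi> (transition M (fst (x i)) (snd (x i)))) (x (Suc i))))"
proof -
  let ?N = "\<lambda>_::nat. count_space UNIV :: ('s \<times> 'a) measure"
  let ?q = "\<lambda>n. case n of 0 \<Rightarrow> pmf D (x 0)
    | Suc m \<Rightarrow> pmf (act \<pi> (transition M (fst (x m)) (snd (x m)))) (x (Suc m))"
  interpret IT: Ionescu_Tulcea "traj_kernel M \<pi> D" ?N
    by (rule Ionescu_Tulcea_traj_kernel)
  let ?r = "\<lambda>n. restrict x {0..<n}"
  have space_PiM_ext: "\<omega> \<in> space (PiM {0..<n} ?N) \<longleftrightarrow> \<omega> \<in> extensional {0..<n}" for \<omega> n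
    by (auto simp: space_PiM PiE_iff)
  have sing: "{?r n} \<in> sets (PiM {0..<n} ?N)" for n
  proof -
    have "{?r n} = PiE {0..<n} (\<lambda>i. {x i})"
      by (auto simp: PiE_iff extensional_def fun_eq_iff restrict_def)
    also have "\<dots> \<in> sets (PiM {0..<n} ?N)"
      by (rule sets_PiM_I_finite) auto
    finally show ?thesis .
  qed
  have C: "emeasure (IT.C 0 n (\<lambda>_. undefined)) {?r n} = ennreal (\<Prod>i<n. ?q i)" for n
  proof (induction n)
    case 0
    show ?case using sing[of 0] by (simp add: restrict_def)
  next
    case (Suc n)
    have u: "(\<lambda>_. undefined) \<in> space (PiM {0..<0} ?N)" by (simp add: space_PiM)
    have spC: "space (IT.C 0 n (\<lambda>_. undefined)) = space (PiM {0..<n} ?N)"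
      using IT.space_C[OF u, of n] by simp
    have setsC: "sets (IT.C 0 n (\<lambda>_. undefined)) = sets (PiM {0..<n} ?N)"
      using IT.sets_C[OF u, of n] by simp
    have ne: "space (IT.C 0 n (\<lambda>_. undefined)) \<noteq> {}"
      unfolding spC using space_PiM_ext[of "?r n" n] by (auto simp: restrict_extensional)
    have meas: "IT.eP n \<in> IT.C 0 n (\<lambda>_. undefined) \<rightarrow>\<^sub>M subprob_algebra (PiM {0..<Suc n} ?N)"
      using IT.measurable_eP measurable_cong_sets[OF setsC refl] by blast
    have step: "emeasure (IT.eP n \<omega>) {?r (Suc n)} = ennreal (?q n) * indicator {?r n} \<omega>"
      if \<omega>: "\<omega> \<in> space (PiM {0..<n} ?N)" for \<omega>
    proof -
      have ext: "\<omega> \<in> extensional {0..<n}" using \<omega> space_PiM_ext by blast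
      have "emeasure (IT.eP n \<omega>) {?r (Suc n)} =
          emeasure (traj_kernel M \<pi> D n \<omega>) ((\<lambda>y. fun_upd \<omega> n y) -` {?r (Suc n)})"
        using IT.emeasure_eP[OF \<omega> sing[of "Suc n"]] by simp
      also have "(\<lambda>y. fun_upd \<omega> n y) -` {?r (Suc n)} = (if \<omega> = ?r n then {x n} else {})"
      proof -
        have "fun_upd \<omega> n y = ?r (Suc n) \<longleftrightarrow> \<omega> = ?r n \<and> y = x n" for y
          using ext unfolding fun_eq_iff extensional_def
          by (auto simp: restrict_def less_Suc_eq split: if_splits)
        then show ?thesis by (auto simp only: vimage_def set_eq_iff mem_Collect_eq singleton_iff empty_iff split: if_split)
      qed
      also have "emeasure (traj_kernel M \<pi> D n \<omega>) \<dots> = ennreal (?q n) * indicator {?r n} \<omega>"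
        by (auto simp: traj_kernel_def emeasure_pmf_single split: nat.split)
      finally show ?thesis .
    qed
    have "emeasure (IT.C 0 (Suc n) (\<lambda>_. undefined)) {?r (Suc n)} =
        (\<integral>\<^sup>+\<omega>. emeasure (IT.eP n \<omega>) {?r (Suc n)} \<partial>IT.C 0 n (\<lambda>_. undefined))"
      using emeasure_bind[OF ne meas sing[of "Suc n"]] by simp
    also have "\<dots> = (\<integral>\<^sup>+\<omega>. ennreal (?q n) * indicator {?r n} \<omega> \<partial>IT.C 0 n (\<lambda>_. undefined))"
      using step spC by (intro nn_integral_cong) simp
    also have "\<dots> = ennreal (?q n) * emeasure (IT.C 0 n (\<lambda>_. undefined)) {?r n}"
      using sing[of n] setsC by (intro nn_integral_cmult_indicator) simp
    also have "\<dots> = ennreal (\<Prod>i<Suc n. ?q i)"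
      unfolding Suc.IH lessThan_Suc
      by (subst ennreal_mult''[symmetric]) (auto intro!: prod_nonneg simp: mult.commute split: nat.split)
    finally show ?case .
  qed
  have "emeasure (traj M \<pi> D) {\<xi>. \<forall>i\<le>n. \<xi> i = x i} =
      emeasure IT.PF.lim (IT.PF.emb UNIV {0..<Suc n} {?r (Suc n)})"
    unfolding traj_def
    by (rule arg_cong[where f="emeasure _"])
       (auto simp: prod_emb_def space_PiM fun_eq_iff restrict_def less_Suc_eq_le split: if_splits)
  also have "\<dots> = emeasure (IT.CI {0..<Suc n}) {?r (Suc n)}"
    by (rule IT.lim) (use sing in auto)
  also have "\<dots> = emeasure (IT.C 0 (Suc n) (\<lambda>_. undefined)) {?r (Suc n)}"
  proof -
    have "IT.PF.emb {0..<Suc n} {0..<Suc n} {?r (Suc n)} = {?r (Suc n)}"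
      using sets.sets_into_space[OF sing[of "Suc n"]] by (intro prod_emb_id) (simp add: space_PiM)
    then show ?thesis
      using IT.emeasure_CI[OF subset_refl sing[of "Suc n"]] by simp
  qed
  also have "\<dots> = ennreal (\<Prod>i<Suc n. ?q i)" by (rule C)
  also have "(\<Prod>i<Suc n. ?q i) = pmf D (x 0) *
      (\<Prod>i<n. pmf (act \<pi> (transition M (fst (x i)) (snd (x i)))) (x (Suc i)))"
    by (subst prod.lessThan_Suc_shift) simp
  finally show ?thesis .
qed


section \<open>Values and optimality\<close>

definition rew :: "('s, 'a) environment \<Rightarrow> ('s, 'a) reward \<Rightarrow> (nat \<Rightarrow> 's \<times> 'a) \<Rightarrow> nat \<Rightarrow> real" where
  "rew M R \<xi> t = disc M ^ t * R (fst (\<xi> t)) (snd (\<xi> t)) (fst (\<xi> (Suc t)))"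

definition exp_return :: "('s, 'a) environment \<Rightarrow> ('s, 'a) reward \<Rightarrow> ('s, 'a) policy \<Rightarrow>
    ('s \<times> 'a) pmf \<Rightarrow> real" where
  "exp_return M R \<pi> D = (\<integral>\<xi>. (\<Sum>t. rew M R \<xi> t) \<partial>traj M \<pi> D)"

definition J_val :: "('s, 'a) environment \<Rightarrow> ('s, 'a) reward \<Rightarrow> ('s, 'a) policy \<Rightarrow> real" where
  "J_val M R \<pi> = exp_return M R \<pi> (act \<pi> (init M))"

definition V_val :: "('s, 'a) environment \<Rightarrow> ('s, 'a) reward \<Rightarrow> ('s, 'a) policy \<Rightarrow> 's \<Rightarrow> real" where
  "V_val M R \<pi> s = exp_return M R \<pi> (act \<pi> (return_pmf s))"

definition Q_val :: "('s, 'a) environment \<Rightarrow> ('s, 'a) reward \<Rightarrow> ('s, 'a) policy \<Rightarrow> 's \<Rightarrow> 'a \<Rightarrow> real" where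
  "Q_val M R \<pi> s a = exp_return M R \<pi> (return_pmf (s, a))"

definition V_opt :: "('s, 'a) environment \<Rightarrow> ('s, 'a) reward \<Rightarrow> 's \<Rightarrow> real" where
  "V_opt M R s = (SUP \<pi>. V_val M R \<pi> s)"

definition Q_opt :: "('s, 'a) environment \<Rightarrow> ('s, 'a) reward \<Rightarrow> 's \<Rightarrow> 'a \<Rightarrow> real" where
  "Q_opt M R s a = (SUP \<pi>. Q_val M R \<pi> s a)"

definition A_opt :: "('s, 'a) environment \<Rightarrow> ('s, 'a) reward \<Rightarrow> 's \<Rightarrow> 'a \<Rightarrow> real" where
  "A_opt M R s a = Q_opt M R s a - V_opt M R s"

text \<open>
  \<open>suminf\<close>, the Bochner integral and \<open>Sup\<close> are total and return junk values outside their
  domain. The next definition says that none of the quantities above is such a junk value,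
  for any reward.
\<close>

definition values_well_defined :: "('s, 'a) environment \<Rightarrow> bool" where
  "values_well_defined M \<longleftrightarrow> (\<forall>R.
     (\<forall>\<pi> D. (AE \<xi> in traj M \<pi> D. summable (rew M R \<xi>)) \<and>
            integrable (traj M \<pi> D) (\<lambda>\<xi>. \<Sum>t. rew M R \<xi> t)) \<and>
     (\<forall>s. bdd_above (range (\<lambda>\<pi>. V_val M R \<pi> s))) \<and>
     (\<forall>s a. bdd_above (range (\<lambda>\<pi>. Q_val M R \<pi> s a))))"

text \<open>
  Since rewards are arbitrary functions (constants in particular), well-definedness excludes
  the undiscounted case and nothing else.
\<close>

lemma values_well_defined_iff:
  fixes M :: "('s::finite, 'a::finite) environment"
  assumes "environment M"
  shows "values_well_defined M \<longleftrightarrow> disc M < 1"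
proof
  assume wd: "values_well_defined M"
  define \<pi> :: "('s, 'a) policy" where "\<pi> = (\<lambda>_. return_pmf undefined)"
  define R :: "('s, 'a) reward" where "R = (\<lambda>_ _ _. 1)"
  let ?T = "traj M \<pi> (return_pmf undefined)"
  interpret prob_space ?T by (rule prob_space_traj)
  have "AE \<xi> in ?T. summable (rew M R \<xi>)"
    using wd unfolding values_well_defined_def by blast
  moreover have "rew M R \<xi> = (\<lambda>t. disc M ^ t)" for \<xi>
    by (auto simp: rew_def R_def)
  ultimately have "summable (\<lambda>t. disc M ^ t)" by simp
  then have "norm (disc M) < 1" by (simp only: summable_geometric_iff)
  then show "disc M < 1" by simp
next
  assume lt: "disc M < 1"
  have pos: "0 < disc M" using assms by (simp add: environment_def)
  show "values_well_defined M"
    unfolding values_well_defined_def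
  proof (intro allI)
    fix R :: "('s, 'a) reward"
    define B where "B = Max (range (\<lambda>(s, a, s'). \<bar>R s a s'\<bar>))"
    have B: "\<bar>R s a s'\<bar> \<le> B" for s a s'
      unfolding B_def by (rule Max_ge) (auto intro: rev_image_eqI[of "(s, a, s')"])
    have rew_le: "norm (rew M R \<xi> t) \<le> B * disc M ^ t" for \<xi> t
      using B pos by (auto simp: rew_def abs_mult mult.commute intro!: mult_right_mono)
    have geo: "summable (\<lambda>t. B * disc M ^ t)"
      using lt pos by (intro summable_mult summable_geometric) simp
    have summ: "summable (rew M R \<xi>)" for \<xi>
      by (rule summable_comparison_test'[OF geo]) (rule rew_le)
    have bound: "norm (\<Sum>t. rew M R \<xi> t) \<le> (\<Sum>t. B * disc M ^ t)" for \<xi>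
    proof -
      have sn: "summable (\<lambda>t. norm (rew M R \<xi> t))"
        by (rule summable_comparison_test'[OF geo]) (use rew_le in simp)
      have "norm (\<Sum>t. rew M R \<xi> t) \<le> (\<Sum>t. norm (rew M R \<xi> t))"
        by (rule summable_norm[OF sn])
      also have "\<dots> \<le> (\<Sum>t. B * disc M ^ t)"
        by (rule suminf_le[OF _ sn geo]) (rule rew_le)
      finally show ?thesis .
    qed
    have int: "integrable (traj M \<pi> D) (\<lambda>\<xi>. \<Sum>t. rew M R \<xi> t)" for \<pi> D
    proof -
      interpret prob_space "traj M \<pi> D" by (rule prob_space_traj)
      have rewm [measurable]: "(\<lambda>\<xi>. rew M R \<xi> t) \<in> borel_measurable (traj M \<pi> D)" for t
      proof -
        have [measurable]: "(\<lambda>\<xi>. \<xi> t) \<in> traj M \<pi> D \<rightarrow>\<^sub>M count_space UNIV" for t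
          by (subst measurable_cong_sets[OF sets_traj refl]) (rule measurable_component_singleton, simp)
        have "(\<lambda>\<xi>. (\<xi> t, \<xi> (Suc t))) \<in> traj M \<pi> D \<rightarrow>\<^sub>M count_space UNIV \<Otimes>\<^sub>M count_space UNIV"
          by measurable
        moreover have "count_space UNIV \<Otimes>\<^sub>M count_space UNIV =
            (count_space UNIV :: (('s \<times> 'a) \<times> ('s \<times> 'a)) measure)"
          by (subst pair_measure_countable) auto
        ultimately have "(\<lambda>\<xi>. (\<xi> t, \<xi> (Suc t))) \<in> traj M \<pi> D \<rightarrow>\<^sub>M count_space UNIV"
          by simp
        from measurable_compose[OF this, of "\<lambda>(x, y). disc M ^ t * R (fst x) (snd x) (fst y)" borel]
        show ?thesis by (simp add: rew_def)
      qed
      show ?thesis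
        by (rule integrable_const_bound[where B="\<Sum>t. B * disc M ^ t"])
           (use bound in \<open>auto intro: borel_measurable_suminf\<close>)
    qed
    have ret: "exp_return M R \<pi> D \<le> (\<Sum>t. B * disc M ^ t)" for \<pi> D
    proof -
      interpret prob_space "traj M \<pi> D" by (rule prob_space_traj)
      show ?thesis
        unfolding exp_return_def
        by (rule integral_le_const[OF int]) (use bound in \<open>auto simp: abs_le_iff\<close>)
    qed
    show "(\<forall>\<pi> D. (AE \<xi> in traj M \<pi> D. summable (rew M R \<xi>)) \<and>
            integrable (traj M \<pi> D) (\<lambda>\<xi>. \<Sum>t. rew M R \<xi> t)) \<and>
     (\<forall>s. bdd_above (range (\<lambda>\<pi>. V_val M R \<pi> s))) \<and>
     (\<forall>s a. bdd_above (range (\<lambda>\<pi>. Q_val M R \<pi> s a)))"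
      using summ int ret by (auto simp: V_val_def Q_val_def intro!: bdd_aboveI2)
  qed
qed

definition opt_actions :: "('s, 'a) environment \<Rightarrow> ('s, 'a) reward \<Rightarrow> 's \<Rightarrow> 'a set" where
  "opt_actions M R s = {a. is_arg_max (A_opt M R s) (\<lambda>_. True) a}"

definition opt_policies :: "('s, 'a) environment \<Rightarrow> ('s, 'a) reward \<Rightarrow> ('s, 'a) policy set" where
  "opt_policies M R = {\<pi>. \<forall>s. set_pmf (\<pi> s) \<subseteq> opt_actions M R s}"


section \<open>Reward objects\<close>

definition admissible :: "('r \<times> 'r) set \<Rightarrow> ('r \<Rightarrow> 'x) \<Rightarrow> bool" where
  "admissible P f \<longleftrightarrow> (\<forall>R\<^sub>1 R\<^sub>2. f R\<^sub>1 = f R\<^sub>2 \<longrightarrow> (R\<^sub>1, R\<^sub>2) \<in> P)"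

definition robust_with :: "('r \<times> 'r) set \<Rightarrow> ('r \<Rightarrow> 'x) \<Rightarrow> ('r \<Rightarrow> 'x) \<Rightarrow> bool" where
  "robust_with P f g \<longleftrightarrow> admissible P f \<and> f \<noteq> g \<and> range g \<subseteq> range f \<and>
     (\<forall>R\<^sub>1 R\<^sub>2. f R\<^sub>1 = g R\<^sub>2 \<longrightarrow> (R\<^sub>1, R\<^sub>2) \<in> P)"

definition OPT :: "('s, 'a) environment \<Rightarrow> (('s, 'a) reward \<times> ('s, 'a) reward) set" where
  "OPT M = {(R\<^sub>1, R\<^sub>2). opt_policies M R\<^sub>1 = opt_policies M R\<^sub>2}"

definition ORD :: "('s, 'a) environment \<Rightarrow> (('s, 'a) reward \<times> ('s, 'a) reward) set" where
  "ORD M = {(R\<^sub>1, R\<^sub>2). \<forall>\<pi> \<pi>'. J_val M R\<^sub>1 \<pi> > J_val M R\<^sub>1 \<pi>' \<longleftrightarrow> J_val M R\<^sub>2 \<pi> > J_val M R\<^sub>2 \<pi>'}"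

text \<open>
  \<open>ORD M\<close> is degenerate for very small environments. With a single action there is only one
  policy, so \<open>ORD M\<close> has one class and everything is admissible. With a single state and
  exactly two actions the policy value is affine in the probability of the first action, so
  \<open>ORD M\<close> has three classes, and these are separated by the set of optimal actions. These are
  the only environments in which some optimal-action selector is admissible for \<open>ORD M\<close>.
\<close>

lemma equiv_OPT: "equiv UNIV (OPT M)"
  by (auto simp: equiv_def refl_on_def sym_def trans_def OPT_def)

lemma equiv_ORD: "equiv UNIV (ORD M)"
  by (auto simp: equiv_def refl_on_def sym_def trans_def ORD_def)

definition opt_selectors :: "('s, 'a) environment \<Rightarrow> (('s, 'a) reward \<Rightarrow> 's \<Rightarrow> 'a set) set" where
  "opt_selectors M = {f. \<forall>R s. f R s \<noteq> {} \<and> f R s \<subseteq> opt_actions M R s}"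

definition max_selector :: "('s, 'a) environment \<Rightarrow> ('s, 'a) reward \<Rightarrow> 's \<Rightarrow> 'a set" where
  "max_selector M = (\<lambda>R s. opt_actions M R s)"

lemma max_selector_in_opt_selectors:
  fixes M :: "('s, 'a::finite) environment"
  shows "max_selector M \<in> opt_selectors M"
proof -
  have "\<exists>a. is_arg_max (A_opt M R s) (\<lambda>_. True) a" for R s
  proof -
    have "Max (range (A_opt M R s)) \<in> range (A_opt M R s)" by (rule Max_in) auto
    then obtain a where "A_opt M R s a = Max (range (A_opt M R s))" by (metis imageE)
    then have "A_opt M R s b \<le> A_opt M R s a" for b by simp
    then show ?thesis by (auto simp: is_arg_max_def not_less)
  qed
  then show ?thesis
    by (auto simp: opt_selectors_def max_selector_def opt_actions_def)
qed

end

theory Submission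
  imports Defs
begin

text \<open>
  The reward \<open>of_bool (a \<in> A s)\<close> has exactly the optimal actions \<open>A s\<close>. So if a selector \<open>f\<close> is
  strict somewhere at \<open>R\<close>, there is \<open>R'\<close> with \<open>opt_actions M R' = f R\<close>; admissibility for
  \<open>OPT M\<close> forbids \<open>f R' = f R\<close>, so \<open>f\<close> is strict at \<open>R'\<close> with smaller values, and the descent
  cannot go on for ever.

  For \<open>ORD M\<close> a selector takes finitely many values, so it is enough to find infinitely many
  classes. They occur in a pencil \<open>c + l * d\<close> of rewards for which some policy \<open>\<rho>\<close> earns only
  \<open>d\<close>-reward and other policies earn only \<open>c\<close>-reward, in arbitrarily small positive amounts: the
  value of \<open>l\<close> at which \<open>\<rho>\<close> ties with such a policy takes infinitely many values, and each of
  them separates the rewards of the pencil.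
\<close>

section \<open>Time marginals of the trajectory measure\<close>

primrec marginal :: "('s, 'a) environment \<Rightarrow> ('s, 'a) policy \<Rightarrow> ('s \<times> 'a) pmf \<Rightarrow> nat \<Rightarrow> ('s \<times> 'a) pmf" where
  "marginal M \<pi> D 0 = D"
| "marginal M \<pi> D (Suc t) =
     bind_pmf (marginal M \<pi> D t) (\<lambda>x. act \<pi> (transition M (fst x) (snd x)))"

text \<open>Keeping only the state lets \<open>marginal_act\<close> and
  \<open>expectation_act\<close> turn the mean reward at time \<open>t\<close> into an average over
  states of the mean reward that the policy earns in each state.\<close>

primrec state_marginal :: "('s, 'a) environment \<Rightarrow> ('s, 'a) policy \<Rightarrow> 's pmf \<Rightarrow> nat \<Rightarrow> 's pmf" where
  "state_marginal M \<pi> p 0 = p"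
| "state_marginal M \<pi> p (Suc t) =
     bind_pmf (act \<pi> (state_marginal M \<pi> p t)) (\<lambda>x. transition M (fst x) (snd x))"

lemma marginal_act: "marginal M \<pi> (act \<pi> p) t = act \<pi> (state_marginal M \<pi> p t)"
  by (induction t) (simp_all add: act_def bind_assoc_pmf)

lemma set_pmf_act: "set_pmf (act \<pi> p) = Sigma (set_pmf p) (\<lambda>s. set_pmf (\<pi> s))"
  by (auto simp: act_def)

lemma traj_component_measurable [measurable]:
  fixes M :: "('s::finite, 'a::finite) environment"
  shows "(\<lambda>\<xi>. \<xi> t) \<in> traj M \<pi> D \<rightarrow>\<^sub>M count_space UNIV"
  by (subst measurable_cong_sets[OF sets_traj refl]) (rule measurable_component_singleton, simp)

lemma space_traj:
  fixes M :: "('s::finite, 'a::finite) environment"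
  shows "space (traj M \<pi> D) = UNIV"
  by (subst sets_eq_imp_space_eq[OF sets_traj]) (simp add: space_PiM)

lemma measure_traj_cylinder:
  fixes M :: "('s::finite, 'a::finite) environment"
  shows "measure (traj M \<pi> D) {\<xi>. \<forall>i\<le>n. \<xi> i = x i} =
    pmf D (x 0) * (\<Prod>i<n. pmf (act \<pi> (transition M (fst (x i)) (snd (x i)))) (x (Suc i)))"
  unfolding measure_def emeasure_traj_cylinder
  by (simp add: prod_nonneg)

lemma sets_traj_cylinder:
  fixes M :: "('s::finite, 'a::finite) environment"
  shows "{\<xi>. \<forall>i\<le>n. \<xi> i = x i} \<in> sets (traj M \<pi> D)"
proof -
  have "{\<xi> \<in> space (traj M \<pi> D). \<forall>i\<in>{..n}. \<xi> i = x i} \<in> sets (traj M \<pi> D)"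
    by measurable
  then show ?thesis by (simp add: space_traj Ball_def)
qed

text \<open>Probabilities are known only for cylinders that start at time 0, so an event about the
  times \<open>n\<close> to \<open>m\<close> is cut into finitely many disjoint cylinders, one for
  each prefix of length \<open>n\<close>.\<close>

lemma measure_traj_split:
  fixes M :: "('s::finite, 'a::finite) environment"
  assumes "n \<le> m"
  shows "measure (traj M \<pi> D) {\<xi>. \<forall>i\<in>{n..m}. \<xi> i = y i} =
    (\<Sum>x\<in>PiE {..<n} (\<lambda>_. UNIV). measure (traj M \<pi> D) {\<xi>. \<forall>i\<le>m. \<xi> i = (if i < n then x i else y i)})"
proof -
  interpret prob_space "traj M \<pi> D" by (rule prob_space_traj)
  let ?E = "\<lambda>x. {\<xi>. \<forall>i\<le>m. \<xi> i = (if i < n then x i else y i)}"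
  let ?X = "PiE {..<n} (\<lambda>_. UNIV :: ('s \<times> 'a) set)"
  have eq: "{\<xi>. \<forall>i\<in>{n..m}. \<xi> i = y i} = \<Union>(?E ` ?X)"
  proof (intro set_eqI iffI)
    fix \<xi> assume "\<xi> \<in> {\<xi>. \<forall>i\<in>{n..m}. \<xi> i = y i}"
    then have "\<xi> \<in> ?E (restrict \<xi> {..<n})" by simp
    moreover have "restrict \<xi> {..<n} \<in> ?X" by simp
    ultimately show "\<xi> \<in> \<Union>(?E ` ?X)" by (rule UN_I[rotated])
  next
    fix \<xi> assume "\<xi> \<in> \<Union>(?E ` ?X)"
    then obtain x where "\<xi> \<in> ?E x" by (rule UN_E)
    then show "\<xi> \<in> {\<xi>. \<forall>i\<in>{n..m}. \<xi> i = y i}" by simp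
  qed
  have "disjoint_family_on ?E ?X"
    unfolding disjoint_family_on_def
  proof (intro ballI impI, rule ccontr)
    fix x x' assume *: "x \<in> ?X" "x' \<in> ?X" "x \<noteq> x'" "?E x \<inter> ?E x' \<noteq> {}"
    then obtain \<xi> where \<xi>: "\<xi> \<in> ?E x" "\<xi> \<in> ?E x'" by blast
    have "x i = x' i" if "i < n" for i
    proof -
      have "i \<le> m" using that assms by simp
      with \<xi>(1) that have "\<xi> i = x i" by simp
      moreover from \<xi>(2) that \<open>i \<le> m\<close> have "\<xi> i = x' i" by simp
      ultimately show ?thesis by simp
    qed
    then have "x = x'" using *(1,2) by (intro PiE_ext) auto
    with *(3) show False by simp
  qed
  moreover have "finite ?X" by (intro finite_PiE) auto
  moreover have "?E ` ?X \<subseteq> events" by (intro image_subsetI sets_traj_cylinder)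
  ultimately show ?thesis
    unfolding eq by (intro finite_measure_finite_Union)
qed

text \<open>This is the Markov property. Extending a cylinder from time \<open>n\<close> to
  \<open>Suc n\<close> multiplies its probability by a factor that does not depend on the prefix, so
  the factor can be pulled out of the sum over prefixes.\<close>

lemma measure_traj_step:
  fixes M :: "('s::finite, 'a::finite) environment"
  shows "measure (traj M \<pi> D) {\<xi>. \<xi> n = z \<and> \<xi> (Suc n) = y} =
    measure (traj M \<pi> D) {\<xi>. \<xi> n = z} * pmf (act \<pi> (transition M (fst z) (snd z))) y"
proof -
  \<comment> \<open>Only the values of \<open>w\<close> at \<open>n\<close> and \<open>Suc n\<close>
    matter, because the prefix covers all earlier times.\<close>
  define w where "w i = (if i = n then z else y)" for i
  let ?\<mu> = "measure (traj M \<pi> D)" and ?p = "pmf (act \<pi> (transition M (fst z) (snd z))) y"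
  let ?E = "\<lambda>m x. {\<xi>. \<forall>i\<le>m. \<xi> i = (if i < n then x i else w i)}"
  let ?X = "PiE {..<n} (\<lambda>_. UNIV :: ('s \<times> 'a) set)"
  have "{n..Suc n} = {n, Suc n}" by auto
  then have "{\<xi>. \<xi> n = z \<and> \<xi> (Suc n) = y} = {\<xi>. \<forall>i\<in>{n..Suc n}. \<xi> i = w i}"
    by (auto simp: w_def)
  then have "?\<mu> {\<xi>. \<xi> n = z \<and> \<xi> (Suc n) = y} = (\<Sum>x\<in>?X. ?\<mu> (?E (Suc n) x))"
    using measure_traj_split[of n "Suc n" M \<pi> D w] by simp
  also have "\<dots> = (\<Sum>x\<in>?X. ?\<mu> (?E n x) * ?p)"
    by (rule sum.cong[OF refl], unfold measure_traj_cylinder prod.lessThan_Suc) (simp add: w_def)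
  also have "\<dots> = (\<Sum>x\<in>?X. ?\<mu> (?E n x)) * ?p"
    by (rule sum_distrib_right[symmetric])
  also have "(\<Sum>x\<in>?X. ?\<mu> (?E n x)) = ?\<mu> {\<xi>. \<forall>i\<in>{n..n}. \<xi> i = w i}"
    by (rule measure_traj_split[symmetric]) simp
  also have "{\<xi>. \<forall>i\<in>{n..n}. \<xi> i = w i} = {\<xi>. \<xi> n = z}"
    by (simp add: w_def)
  finally show ?thesis .
qed

lemma measure_traj_component:
  fixes M :: "('s::finite, 'a::finite) environment"
  shows "measure (traj M \<pi> D) {\<xi>. \<xi> n = y} = pmf (marginal M \<pi> D n) y"
proof (induction n arbitrary: y)
  case 0
  show ?case using measure_traj_cylinder[of M \<pi> D 0 "\<lambda>_. y"] by simp
next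
  case (Suc n)
  interpret prob_space "traj M \<pi> D" by (rule prob_space_traj)
  let ?E = "\<lambda>z. {\<xi>. \<xi> n = z \<and> \<xi> (Suc n) = y}"
  have "?E z \<in> events" for z
  proof -
    have "{\<xi> \<in> space (traj M \<pi> D). \<xi> n = z \<and> \<xi> (Suc n) = y} \<in> events" by measurable
    then show ?thesis by (simp add: space_traj)
  qed
  moreover have "{\<xi>. \<xi> (Suc n) = y} = (\<Union>z\<in>UNIV. ?E z)" by auto
  moreover have "disjoint_family ?E" by (auto simp: disjoint_family_on_def)
  ultimately have "prob {\<xi>. \<xi> (Suc n) = y} = (\<Sum>z\<in>UNIV. prob (?E z))"
    by (simp only:) (rule finite_measure_finite_Union, auto)
  also have "\<dots> = pmf (marginal M \<pi> D (Suc n)) y"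
    by (simp add: measure_traj_step Suc.IH pmf_bind integral_measure_pmf_real[of UNIV] mult.commute)
  finally show ?case .
qed

lemma distr_traj_component:
  fixes M :: "('s::finite, 'a::finite) environment"
  shows "distr (traj M \<pi> D) (count_space UNIV) (\<lambda>\<xi>. \<xi> n) = measure_pmf (marginal M \<pi> D n)"
proof (rule measure_eqI_finite[where A = UNIV])
  interpret prob_space "traj M \<pi> D" by (rule prob_space_traj)
  fix y :: "'s \<times> 'a"
  show "emeasure (distr (traj M \<pi> D) (count_space UNIV) (\<lambda>\<xi>. \<xi> n)) {y} =
      emeasure (measure_pmf (marginal M \<pi> D n)) {y}"
    using measure_traj_component[of M \<pi> D n y]
    by (simp add: emeasure_distr space_traj vimage_def emeasure_eq_measure emeasure_pmf_single)
qed auto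

lemma expectation_act:
  fixes p :: "'s::finite pmf" and \<pi> :: "('s, 'a::finite) policy" and c :: "'s \<Rightarrow> 'a \<Rightarrow> real"
  shows "measure_pmf.expectation (act \<pi> p) (\<lambda>x. c (fst x) (snd x)) =
    measure_pmf.expectation p (\<lambda>s. measure_pmf.expectation (\<pi> s) (c s))"
  unfolding act_def
  by (subst pmf_expectation_bind[of UNIV])
     (auto simp: integral_measure_pmf_real[of UNIV p] mult.commute)

text \<open>Expectations under this mixture are affine in \<open>e\<close>, so rewards earned
  through \<open>a\<close> can be scaled down to any small positive size; the mixture also retains
  the support of \<open>q\<close>.\<close>

definition tilt :: "real \<Rightarrow> 'a \<Rightarrow> 'a pmf \<Rightarrow> 'a pmf" where
  "tilt e a q = bind_pmf (bernoulli_pmf e) (\<lambda>b. if b then return_pmf a else q)"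

lemma expectation_tilt:
  fixes f :: "'a::finite \<Rightarrow> real"
  assumes "0 \<le> e" "e \<le> 1"
  shows "measure_pmf.expectation (tilt e a q) f = e * f a + (1 - e) * measure_pmf.expectation q f"
  unfolding tilt_def using assms
  by (subst pmf_expectation_bind[of UNIV]) (auto simp: UNIV_bool)

lemma set_pmf_tilt:
  assumes "0 < e" "e < 1"
  shows "set_pmf (tilt e a q) = insert a (set_pmf q)"
  using assms by (auto simp: tilt_def split: if_splits)

locale discounted_environment =
  fixes M :: "('s::finite, 'a::finite) environment"
  assumes disc_pos: "0 < disc M" and disc_less_1: "disc M < 1"
    and reachable: "reachable M s"
begin

text \<open>Rewards that ignore the successor state involve one time marginal per term. Finiteness
  bounds them by a constant \<open>B\<close>, and the geometric series then dominates, which allows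
  exchanging sum and integral.\<close>

lemma return_sums:
  "(\<lambda>t. disc M ^ t * measure_pmf.expectation (marginal M \<pi> D t) (\<lambda>x. c (fst x) (snd x))) sums
     exp_return M (\<lambda>s a _. c s a) \<pi> D"
proof -
  interpret prob_space "traj M \<pi> D" by (rule prob_space_traj)
  define B where "B = Max (range (\<lambda>(s, a). \<bar>c s a\<bar>))"
  have B: "\<bar>c s a\<bar> \<le> B" for s a
    unfolding B_def by (rule Max_ge) (auto intro: rev_image_eqI[of "(s, a)"])
  let ?r = "\<lambda>t \<xi>. disc M ^ t * c (fst (\<xi> t)) (snd (\<xi> t))"
  have meas [measurable]: "(\<lambda>\<xi>. c (fst (\<xi> t)) (snd (\<xi> t))) \<in> borel_measurable (traj M \<pi> D)" for t
    using measurable_compose[OF traj_component_measurable, of "\<lambda>x. c (fst x) (snd x)" borel] by simp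
  have le: "norm (?r t \<xi>) \<le> B * disc M ^ t" for t \<xi>
    using B disc_pos by (auto simp: abs_mult mult.commute intro!: mult_right_mono)
  have geo: "summable (\<lambda>t. B * disc M ^ t)"
    using disc_pos disc_less_1 by (intro summable_mult summable_geometric) simp
  have int: "integrable (traj M \<pi> D) (?r t)" for t
    by (rule integrable_const_bound[where B = "B * disc M ^ t"]) (use le in auto)
  have "(\<lambda>t. expectation (?r t)) sums expectation (\<lambda>\<xi>. \<Sum>t. ?r t \<xi>)"
  proof (rule sums_integral[OF int])
    show "AE \<xi> in traj M \<pi> D. summable (\<lambda>t. norm (?r t \<xi>))"
      by (intro AE_I2 summable_comparison_test'[OF geo]) (use le in auto)
    have "expectation (\<lambda>\<xi>. norm (?r t \<xi>)) \<le> B * disc M ^ t" for t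
      by (rule integral_le_const) (use le int in auto)
    then show "summable (\<lambda>t. expectation (\<lambda>\<xi>. norm (?r t \<xi>)))"
      by (intro summable_comparison_test'[OF geo]) auto
  qed
  moreover have "expectation (\<lambda>\<xi>. c (fst (\<xi> t)) (snd (\<xi> t))) =
      measure_pmf.expectation (marginal M \<pi> D t) (\<lambda>x. c (fst x) (snd x))" for t
    by (simp add: distr_traj_component[symmetric] integral_distr)
  ultimately show ?thesis
    by (simp add: exp_return_def rew_def)
qed

lemma J_sums:
  "(\<lambda>t. disc M ^ t * measure_pmf.expectation (state_marginal M \<pi> (init M) t)
       (\<lambda>s. measure_pmf.expectation (\<pi> s) (c s))) sums J_val M (\<lambda>s a _. c s a) \<pi>"
  using return_sums[of \<pi> "act \<pi> (init M)" c]
  by (simp add: J_val_def marginal_act expectation_act)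

lemma geometric_sums_scaled: "(\<lambda>t. disc M ^ t * k) sums (k / (1 - disc M))"
  using sums_mult2[OF geometric_sums[of "disc M"], of k] disc_pos disc_less_1 by simp

text \<open>When every state yields the same mean reward, the state marginals drop out, so the
  transitions have no influence on the value.\<close>

lemma J_const:
  assumes "\<And>s. measure_pmf.expectation (\<pi> s) (c s) = k"
  shows "J_val M (\<lambda>s a _. c s a) \<pi> = k / (1 - disc M)"
  using sums_unique2[OF J_sums[of \<pi> c], of "k / (1 - disc M)"] geometric_sums_scaled[of k]
  by (simp add: assms)

lemma J_linear:
  "J_val M (\<lambda>s a _. c s a + l * d s a) \<pi> = J_val M (\<lambda>s a _. c s a) \<pi> + l * J_val M (\<lambda>s a _. d s a) \<pi>"
proof (rule sums_unique2[OF J_sums])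
  show "(\<lambda>t. disc M ^ t * measure_pmf.expectation (state_marginal M \<pi> (init M) t)
      (\<lambda>s. measure_pmf.expectation (\<pi> s) (\<lambda>a. c s a + l * d s a))) sums
      (J_val M (\<lambda>s a _. c s a) \<pi> + l * J_val M (\<lambda>s a _. d s a) \<pi>)"
    using sums_add[OF J_sums[of \<pi> c] sums_mult[OF J_sums[of \<pi> d], of l]]
    by (simp add: integrable_measure_pmf_finite distrib_left mult.left_commute)
qed

lemma J_le:
  assumes "\<And>s. measure_pmf.expectation (\<pi> s) (c s) \<le> k"
  shows "J_val M (\<lambda>s a _. c s a) \<pi> \<le> k / (1 - disc M)"
proof (rule sums_le[OF _ J_sums geometric_sums_scaled])
  fix t
  show "disc M ^ t * measure_pmf.expectation (state_marginal M \<pi> (init M) t)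
      (\<lambda>s. measure_pmf.expectation (\<pi> s) (c s)) \<le> disc M ^ t * k"
    using assms disc_pos
    by (intro mult_left_mono measure_pmf.integral_le_const integrable_measure_pmf_finite) auto
qed

text \<open>Reachability allows any action at each step; a policy with full support plays all of
  them with positive probability, so it can follow the same path.\<close>

lemma reachable_state_marginal:
  assumes "\<And>s. set_pmf (\<pi> s) = UNIV"
  shows "\<exists>t. s \<in> set_pmf (state_marginal M \<pi> (init M) t)"
  using reachable[of s]
proof induction
  case (reachable_init s)
  then show ?case by (intro exI[of _ 0]) simp
next
  case (reachable_step s s' a)
  then obtain t where "s \<in> set_pmf (state_marginal M \<pi> (init M) t)" by blast
  with reachable_step assms show ?case
    by (intro exI[of _ "Suc t"]) (force simp: set_pmf_act)
qed

text \<open>At some time the state \<open>s\<close> has positive mass, which makes that term of the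
  series positive; no term is negative.\<close>

lemma J_pos:
  assumes full: "\<And>s. set_pmf (\<pi> s) = UNIV"
    and nonneg: "\<And>s. 0 \<le> measure_pmf.expectation (\<pi> s) (c s)"
    and pos: "0 < measure_pmf.expectation (\<pi> s) (c s)"
  shows "0 < J_val M (\<lambda>s a _. c s a) \<pi>"
proof -
  let ?e = "\<lambda>s. measure_pmf.expectation (\<pi> s) (c s)"
  let ?p = "state_marginal M \<pi> (init M)"
  obtain t where t: "s \<in> set_pmf (?p t)"
    using reachable_state_marginal[of \<pi>, OF full] by blast
  have "0 < pmf (?p t) s * ?e s"
    using t pos by (simp add: pmf_positive)
  also have "\<dots> \<le> measure_pmf.expectation (?p t) ?e"
    using member_le_sum[of s UNIV "\<lambda>s. pmf (?p t) s * ?e s"] nonneg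
    by (simp add: integral_measure_pmf_real[of UNIV] mult.commute)
  finally have "0 < disc M ^ t * measure_pmf.expectation (?p t) ?e"
    using disc_pos by simp
  moreover have "0 \<le> disc M ^ t * measure_pmf.expectation (?p t) ?e" for t
    using disc_pos nonneg by simp
  ultimately show ?thesis
    using suminf_pos2[OF sums_summable[OF J_sums[of \<pi> c]]] sums_unique[OF J_sums[of \<pi> c]] by simp
qed

text \<open>The largest possible return is \<open>K\<close>, the reward 1 at every time. Starting
  with an action in \<open>A s\<close> one can attain it by staying inside \<open>A\<close>;
  starting outside, the first reward is lost and at most \<open>K - 1\<close> remains. Subtracting
  \<open>V_opt\<close> does not change which actions are maximal.\<close>

lemma opt_actions_indicator:
  fixes A :: "'s \<Rightarrow> 'a set"
  assumes nonempty: "\<And>s. A s \<noteq> {}"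
  shows "opt_actions M (\<lambda>s a _. of_bool (a \<in> A s)) = A"
proof -
  let ?c = "\<lambda>s a. of_bool (a \<in> A s) :: real"
  let ?R = "\<lambda>s a (_::'s). ?c s a"
  define K where "K = 1 / (1 - disc M)"
  let ?d = "\<lambda>\<pi> s a t. disc M ^ t *
      measure_pmf.expectation (marginal M \<pi> (return_pmf (s, a)) t) (\<lambda>x. ?c (fst x) (snd x))"
  have sums: "?d \<pi> s a sums Q_val M ?R \<pi> s a" for \<pi> s a
    unfolding Q_val_def by (rule return_sums)
  have sumsK: "(\<lambda>t. disc M ^ t) sums K"
    using geometric_sums_scaled[of 1] by (simp add: K_def)
  have term_le: "?d \<pi> s a t \<le> disc M ^ t" for \<pi> s a t
    using disc_pos
    by (intro mult_left_le measure_pmf.integral_le_const integrable_measure_pmf_finite) auto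
  have le: "Q_val M ?R \<pi> s a \<le> K" for \<pi> s a
    by (rule sums_le[OF term_le sums sumsK])
  have le': "Q_val M ?R \<pi> s a \<le> K - 1" if "a \<notin> A s" for \<pi> s a
  proof -
    \<comment> \<open>The series starts with 0 instead of 1, and the geometric series without its
      first term sums to \<open>K - 1\<close>.\<close>
    have "?d \<pi> s a 0 = 0" using that by simp
    then have "(\<lambda>t. ?d \<pi> s a (Suc t)) sums Q_val M ?R \<pi> s a"
      using sums_Suc_iff[of "?d \<pi> s a"] sums[of \<pi> s a] by simp
    moreover have "(\<lambda>t. disc M ^ Suc t) sums (K - 1)"
      using sums_Suc_iff[of "\<lambda>t. disc M ^ t" "K - 1"] sumsK by simp
    ultimately show ?thesis
      by (rule sums_le[OF term_le])
  qed
  define \<rho> where "\<rho> s = return_pmf (SOME a. a \<in> A s)" for s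
  have \<rho>: "a \<in> A s" if "a \<in> set_pmf (\<rho> s)" for s a
    using that nonempty[of s] by (auto simp: \<rho>_def some_in_eq)
  have eq: "Q_val M ?R \<rho> s a = K" if "a \<in> A s" for s a
  proof -
    \<comment> \<open>At time 0 this is the choice of \<open>a\<close>; at later times
      \<open>\<rho>\<close> itself picks the action.\<close>
    have "set_pmf (marginal M \<rho> (return_pmf (s, a)) t) \<subseteq> {x. snd x \<in> A (fst x)}" for t
      by (cases t) (use that \<rho> in \<open>auto simp: set_pmf_act\<close>)
    then have "measure_pmf.expectation (marginal M \<rho> (return_pmf (s, a)) t) (\<lambda>x. ?c (fst x) (snd x)) =
        measure_pmf.expectation (marginal M \<rho> (return_pmf (s, a)) t) (\<lambda>_. 1)" for t
      by (intro integral_cong_AE) (auto simp: AE_measure_pmf_iff)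
    then show ?thesis
      using sums_unique2[OF sums[of \<rho> s a], of K] sumsK by simp
  qed
  have Q_opt_in: "Q_opt M ?R s a = K" if "a \<in> A s" for s a
  proof (rule antisym)
    show "Q_opt M ?R s a \<le> K"
      unfolding Q_opt_def by (rule cSUP_least) (simp_all add: le)
    have "bdd_above (range (\<lambda>\<pi>. Q_val M ?R \<pi> s a))"
      by (rule bdd_aboveI2[OF le])
    from cSUP_upper[OF UNIV_I this, of \<rho>] show "K \<le> Q_opt M ?R s a"
      unfolding Q_opt_def eq[OF that] .
  qed
  have Q_opt_notin: "Q_opt M ?R s a \<le> K - 1" if "a \<notin> A s" for s a
    unfolding Q_opt_def by (rule cSUP_least) (simp_all add: le'[OF that])
  have "a \<in> opt_actions M ?R s \<longleftrightarrow> a \<in> A s" for s a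
  proof -
    obtain b where b: "b \<in> A s" using nonempty by blast
    have "a \<in> opt_actions M ?R s \<longleftrightarrow> (\<forall>b. Q_opt M ?R s b \<le> Q_opt M ?R s a)"
      by (simp add: opt_actions_def is_arg_max_def A_opt_def not_less)
    also have "\<dots> \<longleftrightarrow> a \<in> A s"
    proof
      assume "\<forall>b. Q_opt M ?R s b \<le> Q_opt M ?R s a"
      then have "K \<le> Q_opt M ?R s a" using Q_opt_in[OF b] by metis
      then show "a \<in> A s" using Q_opt_notin[of a s] by linarith
    next
      assume a: "a \<in> A s"
      have "Q_opt M ?R s b \<le> K" for b
        using Q_opt_in[of b s] Q_opt_notin[of b s] by linarith
      then show "\<forall>b. Q_opt M ?R s b \<le> Q_opt M ?R s a"
        using Q_opt_in[OF a] by simp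
    qed
    finally show ?thesis .
  qed
  then show ?thesis by (auto simp: fun_eq_iff)
qed

section \<open>Infinitely many classes of policy orderings\<close>

lemma not_ORD_admissible:
  fixes f :: "('s, 'a) reward \<Rightarrow> 's \<Rightarrow> 'a set"
  assumes small: "\<And>e. 0 < e \<Longrightarrow> \<exists>\<pi>. J_val M (\<lambda>s a _. d s a) \<pi> = 0 \<and>
      0 < J_val M (\<lambda>s a _. c s a) \<pi> \<and> J_val M (\<lambda>s a _. c s a) \<pi> < e"
    and \<rho>: "J_val M (\<lambda>s a _. c s a) \<rho> = 0" "0 < J_val M (\<lambda>s a _. d s a) \<rho>"
  shows "\<not> admissible (ORD M) f"
proof
  assume adm: "admissible (ORD M) f"
  define K where "K = J_val M (\<lambda>s a _. d s a) \<rho>"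
  define R where "R l = (\<lambda>s a (_::'s). c s a + l * d s a)" for l
  \<comment> \<open>Under \<open>R l\<close> the policy \<open>\<rho>\<close> has value
    \<open>l * K\<close>, while a \<open>\<pi>\<close> without \<open>d\<close>-reward keeps its
    \<open>c\<close>-value. So \<open>L\<close> collects the parameters at which
    \<open>\<rho>\<close> ties with such a policy.\<close>
  define L where "L = {J_val M (\<lambda>s a _. c s a) \<pi> / K | \<pi>.
      J_val M (\<lambda>s a _. d s a) \<pi> = 0 \<and> 0 < J_val M (\<lambda>s a _. c s a) \<pi>}"
  have K: "0 < K" using \<rho> by (simp add: K_def)
  have L_small: "\<exists>l\<in>L. 0 < l \<and> l < e" if "0 < e" for e
  proof -
    have "0 < e * K" using that K by simp
    from small[OF this] obtain \<pi> where "J_val M (\<lambda>s a _. d s a) \<pi> = 0"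
      "0 < J_val M (\<lambda>s a _. c s a) \<pi>" "J_val M (\<lambda>s a _. c s a) \<pi> < e * K"
      by blast
    then show ?thesis
      using K by (intro bexI[of _ "J_val M (\<lambda>s a _. c s a) \<pi> / K"]) (auto simp: L_def field_simps)
  qed
  have "infinite L"
  proof
    assume fin: "finite L"
    have ne: "L \<noteq> {}" using L_small[of 1] by auto
    have "0 < Min L"
      using Min_in[OF fin ne] K by (auto simp: L_def)
    then obtain l where "l \<in> L" "l < Min L" using L_small by blast
    then show False using Min_le[OF fin, of l] by simp
  qed
  \<comment> \<open>Pigeonhole: \<open>f\<close> takes values in the finite type of maps from states
    to action sets.\<close>
  then have "\<not> inj_on (\<lambda>l. f (R l)) L"
    using finite_imageD[of "\<lambda>l. f (R l)" L] finite_subset[OF subset_UNIV] by auto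
  then obtain l m where "l \<in> L" "m \<in> L" "f (R l) = f (R m)" "l < m"
    unfolding inj_on_def by (metis linorder_neqE_linordered_idom)
  \<comment> \<open>The policy that ties with \<open>\<rho>\<close> at the larger parameter
    \<open>m\<close> strictly beats it at \<open>l\<close>, which separates \<open>R l\<close> from
    \<open>R m\<close>.\<close>
  from \<open>m \<in> L\<close> obtain \<pi> where \<pi>: "J_val M (\<lambda>s a _. d s a) \<pi> = 0" "J_val M (\<lambda>s a _. c s a) \<pi> = m * K"
    using K by (auto simp: L_def)
  have "J_val M (R l) \<pi> > J_val M (R l) \<rho>" "\<not> J_val M (R m) \<pi> > J_val M (R m) \<rho>"
    using K \<open>l < m\<close> \<pi> \<rho> by (simp_all add: R_def J_linear K_def)
  moreover have "(R l, R m) \<in> ORD M"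
    using adm \<open>f (R l) = f (R m)\<close> by (simp add: admissible_def)
  ultimately show False by (auto simp: ORD_def)
qed

lemma not_ORD_admissible_three_actions:
  fixes f :: "('s, 'a) reward \<Rightarrow> 's \<Rightarrow> 'a set"
  assumes "3 \<le> CARD('a)"
  shows "\<not> admissible (ORD M) f"
proof -
  obtain A :: "'a set" where "card A = 3"
    using assms by (meson obtain_subset_with_card_n)
  then obtain a b z :: 'a where abz: "a \<noteq> b" "a \<noteq> z" "b \<noteq> z"
    by (auto simp: card_3_iff)
  \<comment> \<open>The third action \<open>z\<close> earns neither reward, so mixing a little of
    \<open>a\<close> into it gives a small \<open>c\<close>-value and no
    \<open>d\<close>-value.\<close>
  let ?c = "\<lambda>_ x. of_bool (x = a) :: real" and ?d = "\<lambda>_ x. of_bool (x = b) :: real"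
  show ?thesis
  proof (rule not_ORD_admissible)
    fix r :: real assume r: "0 < r"
    \<comment> \<open>The bound \<open>1/2\<close> keeps \<open>e\<close> a probability below 1; the
      other one makes \<open>e / (1 - disc M)\<close> at most \<open>r / 2\<close>.\<close>
    define e where "e = min (1/2) (r * (1 - disc M) / 2)"
    have e: "0 < e" "e < 1" "e < r * (1 - disc M)"
      using r disc_less_1 by (auto simp: e_def min_def)
    let ?\<pi> = "\<lambda>_::'s. tilt e a (return_pmf z)"
    have "J_val M (\<lambda>s a _. ?c s a) ?\<pi> = e / (1 - disc M)"
      by (rule J_const) (use e abz in \<open>simp add: expectation_tilt\<close>)
    moreover have "J_val M (\<lambda>s a _. ?d s a) ?\<pi> = 0 / (1 - disc M)"
      by (rule J_const) (use e abz in \<open>simp add: expectation_tilt\<close>)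
    moreover have "0 < e / (1 - disc M)" "e / (1 - disc M) < r"
      using e disc_less_1 by (simp_all add: pos_divide_less_eq)
    ultimately show "\<exists>\<pi>. J_val M (\<lambda>s a _. ?d s a) \<pi> = 0 \<and>
        0 < J_val M (\<lambda>s a _. ?c s a) \<pi> \<and> J_val M (\<lambda>s a _. ?c s a) \<pi> < r"
      by (intro exI[of _ ?\<pi>]) simp
  next
    show "J_val M (\<lambda>s a _. ?c s a) (\<lambda>_. return_pmf b) = 0"
      using J_const[of "\<lambda>_. return_pmf b" ?c 0] abz by simp
    show "0 < J_val M (\<lambda>s a _. ?d s a) (\<lambda>_. return_pmf b)"
      using J_const[of "\<lambda>_. return_pmf b" ?d 1] disc_less_1 by simp
  qed
qed

text \<open>
  The reward \<open>c s\<close> lives on the state \<open>s\<close> and averages to zero under the uniform distribution.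
  Hence a policy that is uniform away from \<open>s\<close> earns only \<open>c s\<close>-reward, whatever the transitions.
\<close>

lemma not_ORD_admissible_two_states:
  fixes f :: "('s, 'a) reward \<Rightarrow> 's \<Rightarrow> 'a set"
  assumes "2 \<le> CARD('s)" and two: "2 \<le> CARD('a)"
  shows "\<not> admissible (ORD M) f"
proof -
  obtain S :: "'s set" where "card S = 2"
    using assms(1) by (meson obtain_subset_with_card_n)
  then obtain s1 s2 :: 's where ss: "s1 \<noteq> s2"
    by (auto simp: card_2_iff)
  fix a :: 'a
  let ?u = "pmf_of_set (UNIV :: 'a set)"
  \<comment> \<open>This is the value of \<open>c s\<close> at \<open>s\<close> and the action
    \<open>a\<close>. It is positive because there are at least two actions.\<close>
  define k where "k = 1 - 1 / real CARD('a)"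
  have k: "0 < k" "k \<le> 1" using two by (auto simp: k_def)
  define c where "c s = (\<lambda>s' x. of_bool (s' = s) * (of_bool (x = a) - 1 / real CARD('a)))" for s :: 's
  define \<pi> where "\<pi> e s = (\<lambda>s'. if s' = s then tilt e a ?u else ?u)" for e and s :: 's
  have unif: "measure_pmf.expectation ?u (c s s') = 0" for s s'
    by (simp add: integral_pmf_of_set c_def sum_distrib_left[symmetric] sum_subtractf)
  have exp: "measure_pmf.expectation (\<pi> e s s') (c s'' s') = of_bool (s' = s \<and> s' = s'') * (e * k)"
    if "0 < e" "e < 1" for e s s' s''
    using that unif by (simp add: \<pi>_def expectation_tilt) (simp add: c_def k_def)
  have full: "set_pmf (\<pi> e s s') = UNIV" if "0 < e" "e < 1" for e s s'
    using that by (simp add: \<pi>_def set_pmf_tilt)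
  have zero: "J_val M (\<lambda>s a _. c s'' s a) (\<pi> e s) = 0" if "0 < e" "e < 1" "s \<noteq> s''" for e s s''
    using J_const[of "\<pi> e s" "c s''" 0] that by (simp add: exp)
  have pos: "0 < J_val M (\<lambda>s' a _. c s s' a) (\<pi> e s)" if "0 < e" "e < 1" for e s
    by (rule J_pos[where s = s]) (use that k in \<open>simp_all add: full exp\<close>)
  \<comment> \<open>The tilt at \<open>s2\<close> has a fixed size, here \<open>1/2\<close>, while
    the tilt at \<open>s1\<close> shrinks. The uniform part keeps full support, so \<open>s1\<close>
    and \<open>s2\<close> are visited and both values are positive.\<close>
  show ?thesis
  proof (rule not_ORD_admissible[of "c s2" "c s1" "\<pi> (1/2) s2"])
    fix r :: real assume r: "0 < r"
    define e where "e = min (1/2) (r * (1 - disc M) / 2)"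
    have e: "0 < e" "e < 1" "e < r * (1 - disc M)"
      using r disc_less_1 by (auto simp: e_def min_def)
    have "J_val M (\<lambda>s a _. c s1 s a) (\<pi> e s1) \<le> e / (1 - disc M)"
      by (rule J_le) (use e k in \<open>auto simp: exp mult_left_le\<close>)
    also have "\<dots> < r" using e disc_less_1 by (simp add: field_simps)
    finally show "\<exists>\<pi>. J_val M (\<lambda>s a _. c s2 s a) \<pi> = 0 \<and>
        0 < J_val M (\<lambda>s a _. c s1 s a) \<pi> \<and> J_val M (\<lambda>s a _. c s1 s a) \<pi> < r"
      using e zero pos ss by blast
  qed (use zero pos ss in simp_all)
qed

end

section \<open>Optimal policies, and admissibility and robustness for OPT\<close>

lemma opt_actions_nonempty:
  fixes M :: "('s, 'a::finite) environment"
  shows "opt_actions M R s \<noteq> {}"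
  using max_selector_in_opt_selectors[of M] by (auto simp: opt_selectors_def max_selector_def)

text \<open>The set of optimal policies determines the optimal actions: an action optimal in
  \<open>s\<close> extends to an optimal policy by choosing some optimal action in every other
  state.\<close>

lemma OPT_iff:
  fixes M :: "('s, 'a::finite) environment"
  shows "(R\<^sub>1, R\<^sub>2) \<in> OPT M \<longleftrightarrow> opt_actions M R\<^sub>1 = opt_actions M R\<^sub>2"
proof -
  have "a \<in> opt_actions M R s \<longleftrightarrow> (\<exists>\<pi>\<in>opt_policies M R. a \<in> set_pmf (\<pi> s))" for R s a
  proof
    assume a: "a \<in> opt_actions M R s"
    define \<pi> where "\<pi> s' = return_pmf (if s' = s then a else SOME b. b \<in> opt_actions M R s')" for s'
    have "\<pi> \<in> opt_policies M R"
      using a by (auto simp: opt_policies_def \<pi>_def some_in_eq opt_actions_nonempty)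
    moreover have "a \<in> set_pmf (\<pi> s)" by (simp add: \<pi>_def)
    ultimately show "\<exists>\<pi>\<in>opt_policies M R. a \<in> set_pmf (\<pi> s)" by blast
  qed (auto simp: opt_policies_def)
  then have "opt_actions M R\<^sub>1 = opt_actions M R\<^sub>2" if "opt_policies M R\<^sub>1 = opt_policies M R\<^sub>2"
    using that by (auto simp: fun_eq_iff set_eq_iff)
  moreover have "opt_policies M R\<^sub>1 = opt_policies M R\<^sub>2" if "opt_actions M R\<^sub>1 = opt_actions M R\<^sub>2"
    using that by (simp add: opt_policies_def)
  ultimately show ?thesis by (auto simp: OPT_def)
qed

lemma admissible_max_selector:
  fixes M :: "('s, 'a::finite) environment"
  shows "admissible (OPT M) (max_selector M)"
  by (simp add: admissible_def OPT_iff max_selector_def)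

text \<open>Each \<open>g R\<close> equals \<open>max_selector M R'\<close> for some
  \<open>R'\<close>. Robustness puts \<open>R'\<close> and \<open>R\<close> in one class, on which
  \<open>max_selector M\<close> is constant, so \<open>g\<close> would coincide with it.\<close>

lemma max_selector_not_robust:
  fixes M :: "('s, 'a::finite) environment"
  shows "\<not> robust_with (OPT M) (max_selector M) g"
proof
  assume rob: "robust_with (OPT M) (max_selector M) g"
  have "g R = max_selector M R" for R
  proof -
    obtain R' where R': "max_selector M R' = g R"
      using rob by (auto simp: robust_with_def) (metis rangeE rangeI subsetD)
    then have "(R', R) \<in> OPT M" using rob by (simp add: robust_with_def)
    with R' show ?thesis by (simp add: OPT_iff max_selector_def)
  qed
  then show False using rob by (auto simp: robust_with_def)
qed

lemma (in discounted_environment) OPT_admissible_selector_unique: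
  assumes f: "f \<in> opt_selectors M" and adm: "admissible (OPT M) f"
  shows "f = max_selector M"
proof -
  have "f R = opt_actions M R" for R
  proof (induction R rule: measure_induct_rule[where f = "\<lambda>R. \<Sum>s\<in>UNIV. card (f R s)"])
    case (less R)
    define R' where "R' = (\<lambda>s a (_::'s). of_bool (a \<in> f R s) :: real)"
    have opt: "opt_actions M R' = f R"
      unfolding R'_def by (rule opt_actions_indicator) (use f in \<open>auto simp: opt_selectors_def\<close>)
    have sub: "f R' s \<subseteq> f R s" for s
      using f unfolding opt_selectors_def by (metis (mono_tags, lifting) mem_Collect_eq opt)
    have "f R' = f R"
    proof (rule ccontr)
      assume ne: "f R' \<noteq> f R"
      then obtain s where "f R' s \<subset> f R s" using sub by (auto simp: fun_eq_iff)
      then have "(\<Sum>s\<in>UNIV. card (f R' s)) < (\<Sum>s\<in>UNIV. card (f R s))"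
        using sub by (intro sum_strict_mono_ex1) (auto intro!: card_mono psubset_card_mono bexI[of _ s])
      \<comment> \<open>The induction hypothesis gives \<open>f R' = opt_actions M R'\<close>, which
        is \<open>f R\<close> by \<open>opt\<close>, contrary to \<open>ne\<close>.\<close>
      then show False using less[of R'] opt ne by simp
    qed
    then have "(R', R) \<in> OPT M" using adm by (simp add: admissible_def)
    with opt show ?case by (simp add: OPT_iff)
  qed
  then show ?thesis by (auto simp: max_selector_def fun_eq_iff)
qed

theorem theorem3p3:
  fixes M :: "('s::finite, 'a::finite) environment"
  assumes "environment M" and "values_well_defined M"
  shows
    "(2 \<le> CARD('a) \<and> \<not> (CARD('s) = 1 \<and> CARD('a) = 2) \<longrightarrow>
        (\<forall>f \<in> opt_selectors M. \<not> admissible (ORD M) f)) \<and>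
     {f \<in> opt_selectors M. admissible (OPT M) f} = {max_selector M} \<and>
     (\<nexists>g. robust_with (OPT M) (max_selector M) g)"
proof -
  interpret discounted_environment M
    \<comment> \<open>Well-defined values amount to \<open>disc M < 1\<close>.\<close>
    using assms by unfold_locales (auto simp: environment_def values_well_defined_iff)
  have "\<not> admissible (ORD M) f"
    if "2 \<le> CARD('a) \<and> \<not> (CARD('s) = 1 \<and> CARD('a) = 2)" for f :: "('s, 'a) reward \<Rightarrow> 's \<Rightarrow> 'a set"
  proof (cases "CARD('s) = 1")
    case True
    with that have "3 \<le> CARD('a)" by auto
    then show ?thesis by (rule not_ORD_admissible_three_actions)
  next
    case False
    then have "2 \<le> CARD('s)" using zero_less_card_finite[where 'a = 's] by linarith
    then show ?thesis using that by (intro not_ORD_admissible_two_states) auto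
  qed
  then show ?thesis
    using OPT_admissible_selector_unique max_selector_in_opt_selectors admissible_max_selector
      max_selector_not_robust by blast
qed

end
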